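(* Let $V,W$ be Hilbert spaces, $C\subset V$ and $K\subset W$ nonempty closed convex subsets, $A:V\to W$ a continuous linear operator, and $F:V\to\mathbb{R}$, $G:W\to\mathbb{R}$ convex differentiable functions whose derivatives $F'$, $G'$ are Lipschitz with constants $L_f$, $L_g$, respectively. Let $$L(u,p)=\langle Au,p\rangle+F(u)-G(p),$$ and assume that the set of saddle points of $L$ in $C\times K$ is nonempty. Let $\alpha,\beta$ satisfy $$0<\alpha<\frac{2}{L_g},\qquad 0<\beta<\frac{2}{L_f},\qquad \alpha\beta\left(\lVert A\rVert^2-\frac{L_fL_g}{4}\right)+\frac{\alpha L_g}{2}+\frac{\beta L_f}{2}<1.$$ Then, for every initial point $(u_0,p_0)\in C\times K$ with $\overline u_0=u_0$, the sequence $(u_n,p_n)$ defined by $$\begin{cases}p_{n+1}=\Pi_K\big(p_n+\alpha(A\overline u_n-G'(p_n))\big)\\ u_{n+1}=\Pi_C\big(u_n-\beta(A^*p_{n+1}+F'(u_n))\big)\\ \overline u_{n+1}=2u_{n+1}-u_n\end{cases}\qquad (n\ge 0)$$ converges in $V\times W$ to a saddle point of $L$ in $C\times K$.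
   Context: $V,W$ are real Hilbert spaces; $\langle\cdot,\cdot\rangle$ and $\lVert\cdot\rVert$ denote the inner product and norm on either space, and $\lVert A\rVert$ is the operator norm. Derivatives $F'(u)\in V$, $G'(p)\in W$ are identified with gradients. $A^*$ is the adjoint of $A$. $\Pi_D$ denotes the orthogonal (nearest point) projection onto a nonempty closed convex set $D$. A saddle point of $L$ in $C\times K$ is a pair $(\hat u,\hat p)\in C\times K$ with $L(\hat u,p)\le L(\hat u,\hat p)\le L(u,\hat p)$ for all $u\in C$, $p\in K$. If $L_g=0$ (resp. $L_f=0$), the bound $2/L_g$ (resp. $2/L_f$) is read as $+\infty$.
   Formalization: "Converges in V×W" is proved as weak convergence to one fixed saddle point (norm convergence when V, W are finite-dimensional); norm convergence fails in general: A=0, G=0, F=dist(·,D)²/2, β=1 gives alternating projections (Hundal's counterexample). *)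

theory Defs
  imports "HOL-Analysis.Analysis"
begin

text \<open>A real Hilbert space is a type of sort \<open>{real_inner, complete_space}\<close>.
  The library's \<open>closest_point\<close> has the same body as the projection below but requires the sort
  \<open>heine_borel\<close>, that is, finite dimension. On a nonempty closed convex set in a Hilbert space the
  minimiser exists and is unique.\<close>

definition proj :: "'a::{real_inner, complete_space} set \<Rightarrow> 'a \<Rightarrow> 'a" where
  "proj D x = (SOME y. y \<in> D \<and> (\<forall>z\<in>D. dist x y \<le> dist x z))"

definition lagrangian ::
    "('v::real_inner \<Rightarrow> 'w::real_inner) \<Rightarrow> ('v \<Rightarrow> real) \<Rightarrow> ('w \<Rightarrow> real) \<Rightarrow> 'v \<Rightarrow> 'w \<Rightarrow> real" where
  "lagrangian A F G u p = inner (A u) p + F u - G p"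

definition saddle_points ::
    "('v \<Rightarrow> 'w \<Rightarrow> real) \<Rightarrow> 'v set \<Rightarrow> 'w set \<Rightarrow> ('v \<times> 'w) set" where
  "saddle_points L C K =
     {(uh, ph). uh \<in> C \<and> ph \<in> K \<and> (\<forall>u\<in>C. \<forall>p\<in>K. L uh p \<le> L uh ph \<and> L uh ph \<le> L u ph)}"

text \<open>In a Hilbert space of infinite dimension the convergence of projected primal-dual iterations
  is that of the weak topology. Norm convergence can fail already for \<open>A = 0\<close>, \<open>G = 0\<close> and
  \<open>F = dist(\<cdot>, D)\<^sup>2 / 2\<close> with \<open>D\<close> closed and convex, where the iteration with step 1 is the
  method of alternating projections (Hundal's example).\<close>

definition weakly_converges :: "(nat \<Rightarrow> 'a::real_normed_vector) \<Rightarrow> 'a \<Rightarrow> bool" where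
  "weakly_converges x l \<longleftrightarrow> (\<forall>\<phi>::'a \<Rightarrow> real. bounded_linear \<phi> \<longrightarrow> (\<lambda>n. \<phi> (x n)) \<longlonglongrightarrow> \<phi> l)"

lemma weakly_converges_euclidean_iff:
  fixes x :: "nat \<Rightarrow> 'a::euclidean_space"
  shows "weakly_converges x l \<longleftrightarrow> x \<longlonglongrightarrow> l"
proof
  assume "weakly_converges x l"
  then have "(\<lambda>n. x n \<bullet> b) \<longlonglongrightarrow> l \<bullet> b" for b
    unfolding weakly_converges_def using bounded_linear_inner_left by blast
  then show "x \<longlonglongrightarrow> l"
    by (subst tendsto_componentwise_iff) blast
next
  assume "x \<longlonglongrightarrow> l"
  then show "weakly_converges x l"
    unfolding weakly_converges_def by (auto intro: bounded_linear.tendsto)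
qed

end

theory Submission
  imports Defs
begin

text \<open>The iteration is the forward-backward method in a skewed metric. Put \<open>z\<^sub>n = (u\<^sub>n, p\<^sub>n\<^sub>+\<^sub>1)\<close>:
  with this shift of the dual variable the extrapolated point enters \<open>z\<^sub>n\<^sub>+\<^sub>1\<close> through
  \<open>2 u\<^sub>n\<^sub>+\<^sub>1 - u\<^sub>n\<close>, and the two projection inequalities of a step add up to one variational inequality
  for the bilinear form
  \<open>Q((u,q),(u',q')) = u \<cdot> u' / \<beta> - A u \<cdot> q' - A u' \<cdot> q + q \<cdot> q' / \<alpha>\<close>
  (\<open>primal_dual_step_variational\<close>). The extrapolation is exactly what makes \<open>Q\<close> symmetric.

  Comparing this inequality with the one that a saddle point \<open>s = (v, r)\<close> satisfies leaves the term
  \<open>(F'(u\<^sub>n) - F'(v)) \<cdot> (v - u\<^sub>n\<^sub>+\<^sub>1)\<close> and its analogue for \<open>G\<close>. By the theorem of Baillon and Haddad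
  these are at most \<open>L/4\<close> times the squared step (\<open>gradient_three_point_inequality\<close>), so that, with \<open>d = z\<^sub>n - z\<^sub>n\<^sub>+\<^sub>1\<close>,
  \<open>Q(z\<^sub>n\<^sub>+\<^sub>1 - s, z\<^sub>n\<^sub>+\<^sub>1 - s)\<close> falls short of \<open>Q(z\<^sub>n - s, z\<^sub>n - s)\<close> by at least
  \<open>Q(d, d)\<close> less \<open>L\<^sub>f/2\<close> and \<open>L\<^sub>g/2\<close> times the squared components of \<open>d\<close>
  (\<open>primal_dual_step_fejer\<close>). The assumption on \<open>\<alpha>\<close> and \<open>\<beta>\<close> factors as
  \<open>\<alpha> \<beta> \<parallel>A\<parallel>\<^sup>2 < (1 - \<alpha> L\<^sub>g / 2) (1 - \<beta> L\<^sub>f / 2)\<close>, which, given the upper bounds on \<open>\<alpha>\<close> and \<open>\<beta>\<close>, says precisely that this gain dominates a positive multiple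
  of the squared step (\<open>pd_form_coercive\<close>). Hence \<open>Q(z\<^sub>n - s, z\<^sub>n - s)\<close> converges for every
  saddle point \<open>s\<close>, the iterates are bounded and the steps tend to 0.

  Passing to the limit in the variational inequality, every weak cluster point of \<open>z\<^sub>n\<close> is a saddle point
  (\<open>weak_cluster_point_is_saddle_point\<close>). Opial's argument (\<open>opial_weak_convergence\<close>) then
  forces all weak cluster points to coincide. It needs the weak compactness of bounded sequences, obtained from
  the theorem of Tychonoff and the Riesz representation, with filters in place of subsequences.\<close>

section \<open>Projections and the Riesz representation\<close>

text \<open>By the parallelogram identity the points of the convex set \<open>D\<close> that almost attain the
  distance to \<open>x\<close> form sets of small diameter, so completeness replaces compactness.\<close>
lemma nearest_point_exists:
  fixes D :: "'a::{real_inner, complete_space} set"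
  assumes "D \<noteq> {}" "closed D" "convex D"
  shows "\<exists>y\<in>D. \<forall>z\<in>D. dist x y \<le> dist x z"
proof -
  define d where "d = infdist x D"
  define S where "S n = {y \<in> D. (dist x y)\<^sup>2 \<le> d\<^sup>2 + inverse (real (Suc n))}" for n
  have d0: "0 \<le> d"
    by (simp add: d_def infdist_nonneg)
  have dle: "d \<le> dist x y" if "y \<in> D" for y
    using that by (simp add: d_def infdist_le)
  have closed: "closed (S n)" for n
  proof -
    have "S n = D \<inter> {y. (dist x y)\<^sup>2 \<le> d\<^sup>2 + inverse (real (Suc n))}"
      by (auto simp: S_def)
    then show ?thesis
      using \<open>closed D\<close> by (auto intro!: closed_Int closed_Collect_le continuous_intros)
  qed
  have ne: "S n \<noteq> {}" for n
  proof -
    have "d < sqrt (d\<^sup>2 + inverse (real (Suc n)))"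
      by (rule real_less_rsqrt) simp
    then obtain y where y: "y \<in> D" "dist x y < sqrt (d\<^sup>2 + inverse (real (Suc n)))"
      using cInf_lessD[of "dist x ` D"] \<open>D \<noteq> {}\<close> by (auto simp: d_def infdist_notempty)
    then have "(dist x y)\<^sup>2 \<le> (sqrt (d\<^sup>2 + inverse (real (Suc n))))\<^sup>2"
      by (intro power_mono) auto
    also have "\<dots> = d\<^sup>2 + inverse (real (Suc n))"
      by (simp add: add_nonneg_nonneg)
    finally show ?thesis
      using y(1) by (auto simp: S_def)
  qed
  have mono: "S n \<subseteq> S m" if "m \<le> n" for m n
  proof -
    have "inverse (real (Suc n)) \<le> inverse (real (Suc m))"
      using that by (simp add: le_imp_inverse_le)
    then show ?thesis
      unfolding S_def by (intro Collect_mono) linarith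
  qed
  have diam: "\<exists>n. \<forall>y\<in>S n. \<forall>z\<in>S n. dist y z < e" if "0 < e" for e
  proof -
    have "0 < (e/2)\<^sup>2"
      using that by simp
    then obtain n where n: "inverse (real (Suc n)) < (e/2)\<^sup>2"
      using reals_Archimedean by blast
    have "dist y z < e" if y: "y \<in> S n" and z: "z \<in> S n" for y z
    proof -
      define m where "m = (1/2) *\<^sub>R y + (1/2) *\<^sub>R z"
      have "m \<in> D"
        unfolding m_def using y z \<open>convex D\<close> by (intro convexD) (auto simp: S_def)
      then have "d\<^sup>2 \<le> (dist x m)\<^sup>2"
        using dle d0 by (intro power_mono) auto
      moreover have "(dist y z)\<^sup>2 = 2 * (dist x y)\<^sup>2 + 2 * (dist x z)\<^sup>2 - 4 * (dist x m)\<^sup>2"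
        unfolding m_def dist_norm power2_norm_eq_inner
        by (simp add: inner_diff inner_add inner_commute algebra_simps)
      ultimately have "(dist y z)\<^sup>2 \<le> 4 * inverse (real (Suc n))"
        using y z by (simp add: S_def)
      also have "\<dots> < e\<^sup>2"
        using n by (simp add: power_divide)
      finally show ?thesis
        using \<open>0 < e\<close> by (auto dest: power_less_imp_less_base)
    qed
    then show ?thesis
      by blast
  qed
  obtain y where y: "\<And>n. y \<in> S n"
    using decreasing_closed_nest[of S, OF closed ne mono diam] by metis
  have "(dist x y)\<^sup>2 \<le> d\<^sup>2"
  proof (rule field_le_epsilon)
    fix e :: real
    assume "0 < e"
    then obtain n where "inverse (real (Suc n)) < e"
      using reals_Archimedean by blast
    with y[of n] show "(dist x y)\<^sup>2 \<le> d\<^sup>2 + e"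
      by (simp add: S_def)
  qed
  then have "dist x y \<le> d"
    using d0 by (rule power2_le_imp_le)
  moreover have "y \<in> D"
    using y by (auto simp: S_def)
  moreover have "dist x y \<le> dist x z" if "z \<in> D" for z
    using \<open>dist x y \<le> d\<close> dle[OF that] by linarith
  ultimately show ?thesis
    by blast
qed

lemma
  fixes D :: "'a::{real_inner, complete_space} set"
  assumes "D \<noteq> {}" "closed D" "convex D"
  shows proj_in_set: "proj D x \<in> D"
    and proj_variational: "z \<in> D \<Longrightarrow> (x - proj D x) \<bullet> (z - proj D x) \<le> 0"
proof -
  have "\<exists>y. y \<in> D \<and> (\<forall>z\<in>D. dist x y \<le> dist x z)"
    using nearest_point_exists[OF assms, of x] by blast
  from someI_ex[OF this] have *: "proj D x \<in> D \<and> (\<forall>z\<in>D. dist x (proj D x) \<le> dist x z)"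
    unfolding proj_def .
  then show "proj D x \<in> D"
    by blast
  show "(x - proj D x) \<bullet> (z - proj D x) \<le> 0" if "z \<in> D"
    using any_closest_point_dot[OF assms(3,2), of "proj D x" z x] * that by blast
qed

text \<open>The representing vector is the component of any \<open>a\<close> outside the kernel that is orthogonal to the
  kernel, suitably scaled.\<close>
lemma riesz_representation:
  fixes \<phi> :: "'a::{real_inner, complete_space} \<Rightarrow> real"
  assumes "bounded_linear \<phi>"
  shows "\<exists>l. \<forall>y. \<phi> y = l \<bullet> y"
proof (cases "\<forall>y. \<phi> y = 0")
  case True
  then show ?thesis
    by (intro exI[of _ 0]) simp
next
  case False
  then obtain a where a: "\<phi> a \<noteq> 0"
    by blast
  interpret bounded_linear \<phi>
    by fact
  define N where "N = {y. \<phi> y = 0}"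
  have N: "N \<noteq> {}" "closed N" "convex N"
  proof -
    show "N \<noteq> {}"
      using zero unfolding N_def by blast
    show "closed N"
      unfolding N_def by (intro closed_Collect_eq continuous_on continuous_intros)
    show "convex N"
      by (auto simp: N_def convex_def add scaleR)
  qed
  define b where "b = a - proj N a"
  have pN: "\<phi> (proj N a) = 0"
    using proj_in_set[OF N, of a] by (simp add: N_def)
  then have phib: "\<phi> b = \<phi> a"
    by (simp add: b_def diff)
  then have "b \<noteq> 0"
    using a zero by force
  have orth: "b \<bullet> y = 0" if "\<phi> y = 0" for y
  proof -
    have "b \<bullet> (z - proj N a) \<le> 0" if "\<phi> z = 0" for z
      using proj_variational[OF N, of z a] that by (simp add: N_def b_def)
    from this[of "proj N a + y"] this[of "proj N a - y"] show ?thesis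
      using that pN by (simp add: add diff)
  qed
  have "\<forall>y. \<phi> y = ((\<phi> a / (b \<bullet> b)) *\<^sub>R b) \<bullet> y"
  proof
    fix y
    have "b \<bullet> (y - (\<phi> y / \<phi> a) *\<^sub>R b) = 0"
      using a by (intro orth) (simp add: diff scaleR phib)
    then show "\<phi> y = ((\<phi> a / (b \<bullet> b)) *\<^sub>R b) \<bullet> y"
      using \<open>b \<noteq> 0\<close> a by (simp add: inner_diff_right field_simps)
  qed
  then show ?thesis
    by (rule exI[of "\<lambda>l. \<forall>y. \<phi> y = l \<bullet> y"])
qed

text \<open>\<open>adjoint\<close> is a choice among the maps with this property; that there is one is the Riesz
  representation of the functionals \<open>x \<mapsto> A x \<cdot> y\<close>.\<close>
lemma adjoint_inner:
  fixes A :: "'v::{real_inner, complete_space} \<Rightarrow> 'w::real_inner"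
  assumes "bounded_linear A"
  shows "A x \<bullet> y = x \<bullet> adjoint A y"
proof -
  have ex: "\<exists>w. \<forall>x. A x \<bullet> y = x \<bullet> w" for y
  proof -
    have "bounded_linear (\<lambda>x. A x \<bullet> y)"
      by (intro bounded_linear_inner_left_comp assms)
    from riesz_representation[OF this] show ?thesis
      by (simp add: inner_commute[of _ y] inner_commute)
  qed
  have "\<exists>f. \<forall>x y. A x \<bullet> y = x \<bullet> f y"
    by (rule exI[of _ "\<lambda>y. SOME w. \<forall>x. A x \<bullet> y = x \<bullet> w"]) (use someI_ex[OF ex] in fast)
  then have "\<forall>x y. A x \<bullet> y = x \<bullet> adjoint A y"
    unfolding adjoint_def by (fact someI_ex)
  then show ?thesis
    by (elim allE)
qed

section \<open>Weak cluster points\<close>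

text \<open>Weak convergence along a filter rather than a sequence. A weak cluster point is then a weak limit along a
  finer proper filter; extracting subsequences instead would take a reduction to a separable subspace and a
  diagonal argument.\<close>
definition weak_tendsto :: "('i \<Rightarrow> 'a::real_normed_vector) \<Rightarrow> 'a \<Rightarrow> 'i filter \<Rightarrow> bool" where
  "weak_tendsto x l H \<longleftrightarrow> (\<forall>\<phi>::'a \<Rightarrow> real. bounded_linear \<phi> \<longrightarrow> ((\<lambda>i. \<phi> (x i)) \<longlongrightarrow> \<phi> l) H)"

text \<open>Regard each \<open>x i\<close> as the function \<open>y \<mapsto> x i \<cdot> y\<close>. These functions lie in a product of compact
  intervals, so by Tychonoff they have a pointwise cluster point. It is linear as a pointwise limit
  of linear functions and bounded as an element of the product, hence represented by a vector.\<close>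
lemma bounded_weak_cluster_point:
  fixes x :: "'i \<Rightarrow> 'a::{real_inner, complete_space}"
  assumes bnd: "\<And>i. norm (x i) \<le> M" and "E \<noteq> bot"
  obtains H l where "H \<noteq> bot" "H \<le> E" "weak_tendsto x l H"
proof -
  define f where "f i y = x i \<bullet> y" for i y
  define U where "U = PiE UNIV (\<lambda>y::'a. cball (0::real) (M * norm y))"
  have "compactin (product_topology (\<lambda>_. euclidean) UNIV) U"
    unfolding U_def by (subst compactin_PiE) simp
  then have "compact U"
    by (simp add: euclidean_product_topology)
  moreover have "f i \<in> U" for i
  proof -
    have "\<bar>x i \<bullet> y\<bar> \<le> M * norm y" for y
      using order_trans[OF Cauchy_Schwarz_ineq2 mult_right_mono[OF bnd]] by simp
    then show ?thesis
      by (simp add: U_def f_def PiE_UNIV_domain)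
  qed
  then have "eventually (\<lambda>g. g \<in> U) (filtermap f E)"
    by (simp add: eventually_filtermap)
  moreover have "filtermap f E \<noteq> bot"
    using \<open>E \<noteq> bot\<close> by (simp add: filtermap_bot_iff)
  ultimately obtain \<phi> where \<phi>: "\<phi> \<in> U" "inf (nhds \<phi>) (filtermap f E) \<noteq> bot"
    unfolding compact_filter by blast
  define H where "H = inf E (filtercomap f (nhds \<phi>))"
  have H: "H \<noteq> bot"
  proof
    assume "H = bot"
    then have "eventually (\<lambda>_. False) H"
      by simp
    then obtain P Q where PQ: "eventually P E" "eventually Q (nhds \<phi>)" "\<And>i. P i \<Longrightarrow> \<not> Q (f i)"
      unfolding H_def eventually_inf eventually_filtercomap by blast
    have "eventually (\<lambda>g. \<exists>i. P i \<and> g = f i) (filtermap f E)"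
      using PQ(1) unfolding eventually_filtermap by (rule eventually_mono) blast
    with PQ(2) have "eventually (\<lambda>_. False) (inf (nhds \<phi>) (filtermap f E))"
      unfolding eventually_inf using PQ(3) by blast
    with \<phi>(2) show False
      by (simp add: eventually_False)
  qed
  have "filterlim f (nhds \<phi>) H"
    unfolding H_def by (rule filterlim_mono[OF filterlim_filtercomap]) auto
  then have lim: "((\<lambda>i. x i \<bullet> y) \<longlongrightarrow> \<phi> y) H" for y
    using continuous_on_tendsto_compose[OF continuous_on_product_coordinates[of y], of f \<phi> H]
    by (simp add: f_def)
  have "bounded_linear \<phi>"
  proof (rule bounded_linear_intro)
    show "\<phi> (y + z) = \<phi> y + \<phi> z" for y z
      using tendsto_unique[OF H lim[of "y + z"]] tendsto_add[OF lim lim, of y z]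
      by (simp add: inner_add_right)
    show "\<phi> (r *\<^sub>R y) = r *\<^sub>R \<phi> y" for r y
      using tendsto_unique[OF H lim[of "r *\<^sub>R y"]] tendsto_mult_left[OF lim, of r y] by simp
    show "norm (\<phi> y) \<le> norm y * M" for y
      using \<phi>(1) by (auto simp: U_def PiE_UNIV_domain mult.commute)
  qed
  from riesz_representation[OF this] obtain l where l: "\<forall>y. \<phi> y = l \<bullet> y" ..
  have "weak_tendsto x l H"
    unfolding weak_tendsto_def
  proof (intro allI impI)
    fix \<psi> :: "'a \<Rightarrow> real"
    assume "bounded_linear \<psi>"
    from riesz_representation[OF this] obtain a where "\<forall>y. \<psi> y = a \<bullet> y" ..
    then show "((\<lambda>i. \<psi> (x i)) \<longlongrightarrow> \<psi> l) H"
      using lim[of a] by (simp add: l inner_commute)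
  qed
  moreover have "H \<le> E"
    by (simp add: H_def)
  ultimately show ?thesis
    by (intro that[OF H])
qed

lemma coercive_form_convergent_imp_bounded:
  fixes z :: "nat \<Rightarrow> 'a::real_normed_vector"
  assumes coercive: "0 < c" "\<And>x. c * (norm x)\<^sup>2 \<le> Q x x"
    and conv: "convergent (\<lambda>n. Q (z n - s) (z n - s) :: real)"
  obtains M where "\<And>n. norm (z n) \<le> M"
proof -
  have "Bseq (\<lambda>n. Q (z n - s) (z n - s))"
    using conv by (rule convergent_imp_Bseq)
  then obtain B where B: "\<And>n. \<bar>Q (z n - s) (z n - s)\<bar> \<le> B"
    unfolding Bseq_def by auto
  have "norm (z n) \<le> norm s + sqrt (B / c)" for n
  proof -
    have "c * (norm (z n - s))\<^sup>2 \<le> B"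
      using coercive(2)[of "z n - s"] B[of n] by linarith
    then have "(norm (z n - s))\<^sup>2 \<le> B / c"
      using coercive(1) by (simp add: field_simps)
    then have "norm (z n - s) \<le> sqrt (B / c)"
      by (rule real_le_rsqrt)
    then show ?thesis
      using norm_triangle_sub[of "z n" s] by linarith
  qed
  then show ?thesis
    by (rule that)
qed

text \<open>Opial's lemma for the norm of a coercive form. If \<open>s\<close> and \<open>t\<close> are weak cluster points, then
  \<open>Q (z n - s) (z n - s) - Q (z n - t) (z n - t)\<close> converges, and up to a constant it is \<open>2 * Q (z n) (t - s)\<close>. The limits
  \<open>Q s (t - s)\<close> and \<open>Q t (t - s)\<close> of \<open>Q (z n) (t - s)\<close> along the two filters therefore agree, so that \<open>Q (t - s) (t - s) = 0\<close>. A bounded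
  sequence with a single weak cluster point converges weakly to it.\<close>
lemma opial_weak_convergence:
  fixes z :: "nat \<Rightarrow> 'a::{real_inner, complete_space}" and Q :: "'a \<Rightarrow> 'a \<Rightarrow> real"
  assumes "bounded_bilinear Q"
    and sym: "\<And>x y. Q x y = Q y x"
    and coercive: "0 < c" "\<And>x. c * (norm x)\<^sup>2 \<le> Q x x"
    and "S \<noteq> {}"
    and conv: "\<And>s. s \<in> S \<Longrightarrow> convergent (\<lambda>n. Q (z n - s) (z n - s))"
    and cluster: "\<And>H s. H \<noteq> bot \<Longrightarrow> H \<le> sequentially \<Longrightarrow> weak_tendsto z s H \<Longrightarrow> s \<in> S"
  shows "\<exists>s\<in>S. weakly_converges z s"
proof -
  interpret Q: bounded_bilinear Q
    by fact
  obtain s0 where s0: "s0 \<in> S"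
    using \<open>S \<noteq> {}\<close> by blast
  obtain M where bnd: "\<And>n. norm (z n) \<le> M"
    using coercive_form_convergent_imp_bounded[of c Q z s0, OF coercive conv[OF s0]] by blast
  have unique: "s = t"
    if H: "H \<noteq> bot" "H \<le> sequentially" "weak_tendsto z s H"
      and H': "H' \<noteq> bot" "H' \<le> sequentially" "weak_tendsto z t H'" for H H' s t
  proof -
    have S: "s \<in> S" "t \<in> S"
      using cluster H H' by blast+
    obtain a where a: "(\<lambda>n. Q (z n) (t - s)) \<longlonglongrightarrow> a"
    proof -
      have "convergent (\<lambda>n. (Q (z n - s) (z n - s) - Q (z n - t) (z n - t) + (Q t t - Q s s)) * (1 / 2))"
        by (intro convergent_mult convergent_add convergent_diff convergent_const conv S)
      moreover have "(Q (z n - s) (z n - s) - Q (z n - t) (z n - t) + (Q t t - Q s s)) * (1 / 2)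
          = Q (z n) (t - s)" for n
        using sym[of s "z n"] sym[of t "z n"] by (simp add: Q.diff_left Q.diff_right)
      ultimately show ?thesis
        using that by (auto simp: convergent_def)
    qed
    have "((\<lambda>n. Q (z n) (t - s)) \<longlongrightarrow> Q s (t - s)) H" "((\<lambda>n. Q (z n) (t - s)) \<longlongrightarrow> Q t (t - s)) H'"
      using H H' Q.bounded_linear_left unfolding weak_tendsto_def by blast+
    moreover have "((\<lambda>n. Q (z n) (t - s)) \<longlongrightarrow> a) H" "((\<lambda>n. Q (z n) (t - s)) \<longlongrightarrow> a) H'"
      using a H H' tendsto_mono by blast+
    ultimately have "Q s (t - s) = a" "Q t (t - s) = a"
      using H H' tendsto_unique by blast+
    then have "Q (t - s) (t - s) = 0"
      by (simp add: Q.diff_left)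
    then have "c * (norm (t - s))\<^sup>2 \<le> 0"
      using coercive(2)[of "t - s"] by simp
    then show ?thesis
      using coercive(1) by (simp add: mult_le_0_iff)
  qed
  obtain H s where H: "H \<noteq> bot" "H \<le> sequentially" "weak_tendsto z s H"
    using bounded_weak_cluster_point[of z, OF bnd, of sequentially] by auto
  have "weakly_converges z s"
    unfolding weakly_converges_def
  proof (intro allI impI, rule ccontr)
    fix \<phi> :: "'a \<Rightarrow> real"
    assume \<phi>: "bounded_linear \<phi>" and "\<not> (\<lambda>n. \<phi> (z n)) \<longlonglongrightarrow> \<phi> s"
    then obtain e where e: "0 < e" "\<not> eventually (\<lambda>n. dist (\<phi> (z n)) (\<phi> s) < e) sequentially"
      unfolding tendsto_iff by blast
    \<comment> \<open>If convergence failed for \<open>\<phi>\<close>, a cluster point along the bad indices would differ from \<open>s\<close>.\<close>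
    define E where "E = inf sequentially (principal {n. \<not> dist (\<phi> (z n)) (\<phi> s) < e})"
    have "E \<noteq> bot"
      using e(2) unfolding E_def by (simp add: trivial_limit_def eventually_inf_principal)
    then obtain H' t where H': "H' \<noteq> bot" "H' \<le> E" "weak_tendsto z t H'"
      using bounded_weak_cluster_point[of z, OF bnd] by metis
    have "H' \<le> sequentially"
      using H'(2) by (simp add: E_def)
    then have "t = s"
      using unique H H' by blast
    then have "((\<lambda>n. \<phi> (z n)) \<longlongrightarrow> \<phi> s) H'"
      using H'(3) \<phi> by (auto simp: weak_tendsto_def)
    then have "eventually (\<lambda>n. dist (\<phi> (z n)) (\<phi> s) < e) H'"
      using e(1) by (auto simp: tendsto_iff)
    moreover have "eventually (\<lambda>n. \<not> dist (\<phi> (z n)) (\<phi> s) < e) H'"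
      using filter_leD[OF H'(2), of "\<lambda>n. \<not> dist (\<phi> (z n)) (\<phi> s) < e"]
      by (simp add: E_def eventually_inf_principal)
    ultimately have "eventually (\<lambda>_. False) H'"
      by eventually_elim simp
    with H'(1) show False
      by (simp add: eventually_False)
  qed
  with cluster[OF H] show ?thesis
    by blast
qed

section \<open>Convex functions with Lipschitz gradient\<close>

lemma gderiv_along_line:
  assumes "GDERIV f (x + t *\<^sub>R d) :> g"
  shows "((\<lambda>t. f (x + t *\<^sub>R d)) has_real_derivative g \<bullet> d) (at t)"
proof -
  have "((\<lambda>t. x + t *\<^sub>R d) has_derivative (\<lambda>h. h *\<^sub>R d)) (at t)"
    by (auto intro!: derivative_eq_intros)
  then have "((\<lambda>t. f (x + t *\<^sub>R d)) has_derivative (\<lambda>h. (h *\<^sub>R d) \<bullet> g)) (at t)"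
    using assms unfolding gderiv_def by (rule has_derivative_compose)
  then show ?thesis
    unfolding has_field_derivative_def
    by (rule has_derivative_eq_rhs) (auto simp: inner_commute mult.commute)
qed

lemma deriv_nonneg_at_left_end_minimum:
  fixes h :: "real \<Rightarrow> real"
  assumes "(h has_real_derivative l) (at 0)" "\<And>t. 0 < t \<Longrightarrow> t \<le> 1 \<Longrightarrow> h 0 \<le> h t"
  shows "0 \<le> l"
proof (rule ccontr)
  assume "\<not> 0 \<le> l"
  then obtain d where d: "0 < d" "\<And>t. 0 < t \<Longrightarrow> t < d \<Longrightarrow> h t < h 0"
    using DERIV_neg_dec_right[OF assms(1)] by auto
  then have "h (min (d / 2) 1) < h 0" 
    by (intro d(2)) (auto simp: min_def)
  moreover have "h 0 \<le> h (min (d / 2) 1)"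
    using d by (intro assms(2)) auto
  ultimately show False
    by simp
qed

lemma convex_gradient_inequality:
  fixes f :: "'a::real_inner \<Rightarrow> real"
  assumes "convex_on UNIV f" "GDERIV f x :> g"
  shows "f x + g \<bullet> (y - x) \<le> f y"
proof -
  define h where "h t = f x + t * (f y - f x) - f (x + t *\<^sub>R (y - x))" for t
  have "((\<lambda>t. f (x + t *\<^sub>R (y - x))) has_real_derivative g \<bullet> (y - x)) (at 0)"
    using assms(2) by (intro gderiv_along_line) simp
  then have "(h has_real_derivative f y - f x - g \<bullet> (y - x)) (at 0)"
    unfolding h_def by (auto intro!: derivative_eq_intros)
  moreover have "h 0 \<le> h t" if "0 < t" "t \<le> 1" for t
  proof -
    have "f ((1 - t) *\<^sub>R x + t *\<^sub>R y) \<le> (1 - t) * f x + t * f y"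
      using that by (intro convex_onD[OF assms(1)]) auto
    moreover have "(1 - t) *\<^sub>R x + t *\<^sub>R y = x + t *\<^sub>R (y - x)"
      by (simp add: algebra_simps)
    ultimately show ?thesis
      by (simp add: h_def algebra_simps)
  qed
  ultimately have "0 \<le> f y - f x - g \<bullet> (y - x)"
    by (rule deriv_nonneg_at_left_end_minimum)
  then show ?thesis
    by simp
qed

lemma first_order_optimality:
  fixes f :: "'a::real_inner \<Rightarrow> real"
  assumes "convex D" "x \<in> D" "y \<in> D" "GDERIV f x :> g"
    and min: "\<And>z. z \<in> D \<Longrightarrow> f x + a \<bullet> x \<le> f z + a \<bullet> z"
  shows "0 \<le> (g + a) \<bullet> (y - x)"
proof -
  define h where "h t = f (x + t *\<^sub>R (y - x)) + a \<bullet> x + t * (a \<bullet> (y - x))" for t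
  have "((\<lambda>t. f (x + t *\<^sub>R (y - x))) has_real_derivative g \<bullet> (y - x)) (at 0)"
    using assms(4) by (intro gderiv_along_line) simp
  then have "(h has_real_derivative (g + a) \<bullet> (y - x)) (at 0)"
    unfolding h_def by (auto intro!: derivative_eq_intros simp: inner_add_left)
  moreover have "h 0 \<le> h t" if "0 < t" "t \<le> 1" for t
  proof -
    have "(1 - t) *\<^sub>R x + t *\<^sub>R y \<in> D"
      using that assms(1-3) by (intro convexD) auto
    moreover have "(1 - t) *\<^sub>R x + t *\<^sub>R y = x + t *\<^sub>R (y - x)"
      by (simp add: algebra_simps)
    ultimately have "x + t *\<^sub>R (y - x) \<in> D"
      by simp
    from min[OF this] show ?thesis
      by (simp add: h_def inner_add_right)
  qed
  ultimately show ?thesis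
    by (rule deriv_nonneg_at_left_end_minimum)
qed

lemma descent_inequality:
  fixes f :: "'a::real_inner \<Rightarrow> real"
  assumes der: "\<And>x. GDERIV f x :> f' x" and lip: "L-lipschitz_on UNIV f'"
  shows "f y \<le> f x + f' x \<bullet> (y - x) + L / 2 * (norm (y - x))\<^sup>2"
proof -
  define d where "d = y - x"
  define h where "h t = f (x + t *\<^sub>R d) - t * (f' x \<bullet> d) - L / 2 * t\<^sup>2 * (norm d)\<^sup>2" for t
  have "h 1 \<le> h 0"
  proof (rule DERIV_nonpos_imp_nonincreasing[of 0 1 h])
    fix t :: real
    assume t: "0 \<le> t" "t \<le> 1"
    have "(h has_real_derivative f' (x + t *\<^sub>R d) \<bullet> d - f' x \<bullet> d - L * t * (norm d)\<^sup>2) (at t)"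
      unfolding h_def by (auto intro!: derivative_eq_intros gderiv_along_line[OF der])
    moreover have "f' (x + t *\<^sub>R d) \<bullet> d - f' x \<bullet> d - L * t * (norm d)\<^sup>2 \<le> 0"
    proof -
      have "f' (x + t *\<^sub>R d) \<bullet> d - f' x \<bullet> d \<le> norm (f' (x + t *\<^sub>R d) - f' x) * norm d"
        using norm_cauchy_schwarz[of "f' (x + t *\<^sub>R d) - f' x" d] by (simp add: inner_diff_left)
      also have "\<dots> \<le> (L * norm (t *\<^sub>R d)) * norm d"
        using lipschitz_onD[OF lip, of "x + t *\<^sub>R d" x]
        by (intro mult_right_mono) (auto simp: dist_norm)
      finally show ?thesis
        using t by (simp add: power2_eq_square mult.assoc)
    qed
    ultimately show "\<exists>l. (h has_real_derivative l) (at t) \<and> l \<le> 0"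
      by blast
  qed simp
  then show ?thesis
    by (simp add: h_def d_def)
qed

text \<open>Cocoercivity of the gradient. The convex function \<open>f - f' x \<cdot> (_)\<close> is minimal at \<open>x\<close>; comparing its minimum with its value after a
  gradient step of length \<open>1/L\<close> from \<open>y\<close> sharpens the gradient inequality by
  \<open>(norm (f' x - f' y))\<^sup>2 / (2 * L)\<close>. Adding the same with \<open>x\<close> and \<open>y\<close> exchanged gives the claim.\<close>
lemma baillon_haddad:
  fixes f :: "'a::real_inner \<Rightarrow> real"
  assumes conv: "convex_on UNIV f" and der: "\<And>x. GDERIV f x :> f' x"
    and lip: "L-lipschitz_on UNIV f'"
  shows "(norm (f' x - f' y))\<^sup>2 \<le> L * ((f' x - f' y) \<bullet> (x - y))"
proof (cases "L = 0")
  case True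
  then show ?thesis
    using lipschitz_onD[OF lip, of x y] by simp
next
  case False
  then have L: "0 < L"
    using lipschitz_on_nonneg[OF lip] by simp
  have *: "(norm (f' x - f' y))\<^sup>2 / (2 * L) \<le> f y - f x - f' x \<bullet> (y - x)" for x y
  proof -
    define d where "d = f' y - f' x"
    define w where "w = y - (1 / L) *\<^sub>R d"
    have "f x + f' x \<bullet> (w - x) \<le> f w"
      by (rule convex_gradient_inequality[OF conv der])
    also have "f w \<le> f y + f' y \<bullet> (w - y) + L / 2 * (norm (w - y))\<^sup>2"
      by (rule descent_inequality[OF der lip])
    finally have "f' y \<bullet> (y - w) - f' x \<bullet> (y - w) - L / 2 * (norm (w - y))\<^sup>2 \<le> f y - f x - f' x \<bullet> (y - x)"
      by (simp add: inner_diff_right)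
    moreover have "f' y \<bullet> (y - w) - f' x \<bullet> (y - w) = (norm d)\<^sup>2 / L"
      unfolding inner_diff_left[symmetric] d_def[symmetric]
      by (simp add: w_def power2_norm_eq_inner)
    moreover have "L / 2 * (norm (w - y))\<^sup>2 = (norm d)\<^sup>2 / (2 * L)"
      using L by (simp add: w_def power_divide power2_eq_square field_simps)
    moreover have "norm (f' x - f' y) = norm d"
      by (simp add: d_def norm_minus_commute)
    ultimately show ?thesis
      by (simp add: field_simps)
  qed
  have "(norm (f' x - f' y))\<^sup>2 / L \<le> (f' x - f' y) \<bullet> (x - y)"
    using *[of x y] *[of y x] by (simp add: norm_minus_commute inner_diff field_simps)
  then show ?thesis
    using L by (simp add: field_simps)
qed

text \<open>The gradient is evaluated at the old iterate \<open>x\<close> but tested at the new one \<open>z\<close>. Cocoercivity absorbs this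
  mismatch: for \<open>d = f' x - f' y\<close> one has \<open>d \<cdot> (x - z) \<le> (norm d)\<^sup>2 / L + L / 4 * (norm (x - z))\<^sup>2\<close>. The constant
  \<open>L / 4\<close> is what permits step sizes up to \<open>2 / L\<close>; the descent inequality alone
  would only give \<open>L / 2\<close>.\<close>
lemma gradient_three_point_inequality:
  fixes f :: "'a::real_inner \<Rightarrow> real"
  assumes conv: "convex_on UNIV f" and der: "\<And>x. GDERIV f x :> f' x"
    and lip: "L-lipschitz_on UNIV f'"
  shows "(f' x - f' y) \<bullet> (y - z) \<le> L / 4 * (norm (x - z))\<^sup>2"
proof (cases "L = 0")
  case True
  then show ?thesis
    using lipschitz_onD[OF lip, of x y] by simp
next
  case False
  then have L: "0 < L"
    using lipschitz_on_nonneg[OF lip] by simp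
  define d where "d = f' x - f' y"
  have "L * (d \<bullet> (y - z)) = L * (d \<bullet> (x - z)) - L * (d \<bullet> (x - y))"
    by (simp add: inner_diff_right algebra_simps)
  also have "\<dots> \<le> L * (d \<bullet> (x - z)) - (norm d)\<^sup>2"
    using baillon_haddad[OF assms, of x y] by (simp add: d_def)
  also have "\<dots> \<le> (L / 2)\<^sup>2 * (norm (x - z))\<^sup>2"
  proof -
    have "0 \<le> (norm ((L / 2) *\<^sub>R (x - z) - d))\<^sup>2"
      by simp
    also have "\<dots> = (L / 2)\<^sup>2 * (norm (x - z))\<^sup>2 - L * (d \<bullet> (x - z)) + (norm d)\<^sup>2"
      unfolding power2_norm_eq_inner
      by (simp add: inner_diff inner_commute power2_eq_square algebra_simps)
    finally show ?thesis
      by simp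
  qed
  finally have "L * (d \<bullet> (y - z)) \<le> L * (L / 4 * (norm (x - z))\<^sup>2)"
    by (simp add: power2_eq_square)
  then show ?thesis
    using L by (simp add: d_def)
qed

section \<open>The metric of the iteration\<close>

text \<open>The form of the block operator with diagonal \<open>1/\<beta>\<close>, \<open>1/\<alpha>\<close> and off-diagonal blocks \<open>-A\<close> and minus the adjoint
  of \<open>A\<close>, written with \<open>A\<close> only, so that it makes sense without the adjoint.\<close>
definition pd_form :: "('v::real_inner \<Rightarrow> 'w::real_inner) \<Rightarrow> real \<Rightarrow> real \<Rightarrow> 'v \<times> 'w \<Rightarrow> 'v \<times> 'w \<Rightarrow> real" where
  "pd_form A \<alpha> \<beta> z z' =
     fst z \<bullet> fst z' / \<beta> - A (fst z) \<bullet> snd z' - A (fst z') \<bullet> snd z + snd z \<bullet> snd z' / \<alpha>"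

lemma pd_form_commute: "pd_form A \<alpha> \<beta> z z' = pd_form A \<alpha> \<beta> z' z"
  by (simp add: pd_form_def inner_commute)

lemma bounded_bilinear_pd_form:
  assumes "bounded_linear A"
  shows "bounded_bilinear (pd_form A \<alpha> \<beta>)"
proof -
  interpret A: bounded_linear A
    by fact
  obtain k where k: "\<And>x. norm (A x) \<le> norm x * k" "0 \<le> k"
    using A.nonneg_bounded by blast
  show ?thesis
  proof
    show "\<exists>N. \<forall>z z'. norm (pd_form A \<alpha> \<beta> z z') \<le> norm z * norm z' * N"
    proof (intro exI allI)
      fix z z' :: "'a \<times> 'b"
      have le: "norm (fst z) \<le> norm z" "norm (snd z) \<le> norm z"
        "norm (fst z') \<le> norm z'" "norm (snd z') \<le> norm z'"
        by (cases z; cases z'; simp add: norm_fst_le norm_snd_le)+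
      have "\<bar>fst z \<bullet> fst z'\<bar> \<le> norm z * norm z'"
        by (rule order_trans[OF Cauchy_Schwarz_ineq2 mult_mono]) (use le in auto)
      then have 1: "\<bar>fst z \<bullet> fst z' / \<beta>\<bar> \<le> norm z * norm z' * (1 / \<bar>\<beta>\<bar>)"
        by (simp add: divide_right_mono)
      have "\<bar>snd z \<bullet> snd z'\<bar> \<le> norm z * norm z'"
        by (rule order_trans[OF Cauchy_Schwarz_ineq2 mult_mono]) (use le in auto)
      then have 2: "\<bar>snd z \<bullet> snd z' / \<alpha>\<bar> \<le> norm z * norm z' * (1 / \<bar>\<alpha>\<bar>)"
        by (simp add: divide_right_mono)
      have An: "norm (A x) \<le> norm y * k" if "norm x \<le> norm y" for x and y :: "'a \<times> 'b"
        using k(1)[of x] mult_right_mono[OF that k(2)] by linarith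
      have 3: "\<bar>A (fst z) \<bullet> snd z'\<bar> \<le> (norm z * k) * norm z'"
        by (rule order_trans[OF Cauchy_Schwarz_ineq2 mult_mono]) (use le An k(2) in auto)
      have 4: "\<bar>A (fst z') \<bullet> snd z\<bar> \<le> (norm z' * k) * norm z"
        by (rule order_trans[OF Cauchy_Schwarz_ineq2 mult_mono]) (use le An k(2) in auto)
      have "\<bar>pd_form A \<alpha> \<beta> z z'\<bar> \<le> \<bar>fst z \<bullet> fst z' / \<beta>\<bar> + \<bar>A (fst z) \<bullet> snd z'\<bar>
          + \<bar>A (fst z') \<bullet> snd z\<bar> + \<bar>snd z \<bullet> snd z' / \<alpha>\<bar>"
        unfolding pd_form_def by linarith
      also have "\<dots> \<le> norm z * norm z' * (1 / \<bar>\<beta>\<bar> + 2 * k + 1 / \<bar>\<alpha>\<bar>)"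
        using 1 2 3 4 by (simp add: algebra_simps)
      finally show "norm (pd_form A \<alpha> \<beta> z z') \<le> norm z * norm z' * (1 / \<bar>\<beta>\<bar> + 2 * k + 1 / \<bar>\<alpha>\<bar>)"
        by simp
    qed
  qed (simp_all add: pd_form_def inner_add A.add A.scaleR add_divide_distrib algebra_simps)
qed

text \<open>The constant is determinant over trace of the matrix of the quadratic form, a lower bound for its smaller
  eigenvalue.\<close>
lemma weighted_cross_term_dominated:
  fixes a b m :: real
  assumes "0 < a" "0 < b" "m\<^sup>2 < a * b"
  obtains c where "0 < c" "\<And>x y. c * (x\<^sup>2 + y\<^sup>2) \<le> a * x\<^sup>2 - 2 * m * (x * y) + b * y\<^sup>2"
proof
  define c where "c = (a * b - m\<^sup>2) / (a + b)"
  show "0 < c"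
    using assms by (simp add: c_def)
  show "c * (x\<^sup>2 + y\<^sup>2) \<le> a * x\<^sup>2 - 2 * m * (x * y) + b * y\<^sup>2" for x y
  proof -
    have c: "c * (a + b) = a * b - m\<^sup>2"
      using assms by (simp add: c_def)
    have "c * a < a * a"
    proof -
      have "c * (a + b) < a * (a + b)"
        unfolding c using assms by (simp add: algebra_simps add_pos_nonneg)
      then show ?thesis
        using assms by (simp add: mult_less_cancel_right)
    qed
    then have ac: "0 < a - c"
      using assms by simp
    have "(a - c) * (b - c) = m\<^sup>2 + c\<^sup>2"
      using c by (simp add: algebra_simps power2_eq_square)
    \<comment> \<open>Completing the square; the choice of \<open>c\<close> leaves the surplus \<open>c\<^sup>2\<close> in the determinant.\<close>
    then have "(a - c) * (a * x\<^sup>2 - 2 * m * (x * y) + b * y\<^sup>2 - c * (x\<^sup>2 + y\<^sup>2))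
        = ((a - c) * x - m * y)\<^sup>2 + (c * y)\<^sup>2"
      by algebra
    then have "0 \<le> (a - c) * (a * x\<^sup>2 - 2 * m * (x * y) + b * y\<^sup>2 - c * (x\<^sup>2 + y\<^sup>2))"
      by simp
    then show ?thesis
      using ac by (simp add: zero_le_mult_iff)
  qed
qed

text \<open>With \<open>a = 1/\<beta> - L\<^sub>f/2\<close> and \<open>b = 1/\<alpha> - L\<^sub>g/2\<close> the step size condition is \<open>\<parallel>A\<parallel>\<^sup>2 < a * b\<close>, the positivity of the
  determinant.\<close>
lemma pd_form_coercive:
  assumes A: "bounded_linear A" and pos: "0 < \<alpha>" "0 < \<beta>" "0 \<le> L\<^sub>f" "0 \<le> L\<^sub>g"
    and \<alpha>: "L\<^sub>g \<noteq> 0 \<longrightarrow> \<alpha> < 2 / L\<^sub>g" and \<beta>: "L\<^sub>f \<noteq> 0 \<longrightarrow> \<beta> < 2 / L\<^sub>f"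
    and step: "\<alpha> * \<beta> * ((onorm A)\<^sup>2 - L\<^sub>f * L\<^sub>g / 4) + \<alpha> * L\<^sub>g / 2 + \<beta> * L\<^sub>f / 2 < 1"
  obtains c where "0 < c"
    "\<And>d. c * (norm d)\<^sup>2 \<le> pd_form A \<alpha> \<beta> d d - L\<^sub>f / 2 * (norm (fst d))\<^sup>2 - L\<^sub>g / 2 * (norm (snd d))\<^sup>2"
proof -
  define a b where "a = 1 / \<beta> - L\<^sub>f / 2" and "b = 1 / \<alpha> - L\<^sub>g / 2"
  have "\<alpha> * L\<^sub>g < 2"
    using \<alpha> pos by (cases "L\<^sub>g = 0") (simp_all add: field_simps)
  moreover have "\<beta> * L\<^sub>f < 2"
    using \<beta> pos by (cases "L\<^sub>f = 0") (simp_all add: field_simps)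
  ultimately have "0 < a" "0 < b"
    using pos by (simp_all add: a_def b_def field_simps)
  have "\<alpha> * \<beta> * (onorm A)\<^sup>2 < (1 - \<beta> * L\<^sub>f / 2) * (1 - \<alpha> * L\<^sub>g / 2)"
    using step by (simp add: algebra_simps)
  also have "\<dots> = \<alpha> * \<beta> * (a * b)"
    using pos by (simp add: a_def b_def field_simps)
  finally have "(onorm A)\<^sup>2 < a * b"
    using pos by simp
  with \<open>0 < a\<close> \<open>0 < b\<close> obtain c where c: "0 < c"
    "\<And>x y. c * (x\<^sup>2 + y\<^sup>2) \<le> a * x\<^sup>2 - 2 * onorm A * (x * y) + b * y\<^sup>2"
    by (rule weighted_cross_term_dominated) blast
  have "c * (norm d)\<^sup>2 \<le> pd_form A \<alpha> \<beta> d d - L\<^sub>f / 2 * (norm (fst d))\<^sup>2 - L\<^sub>g / 2 * (norm (snd d))\<^sup>2" for d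
  proof -
    have "A (fst d) \<bullet> snd d \<le> norm (A (fst d)) * norm (snd d)"
      by (rule norm_cauchy_schwarz)
    also have "\<dots> \<le> onorm A * norm (fst d) * norm (snd d)"
      by (intro mult_right_mono onorm A) simp
    finally have cross: "A (fst d) \<bullet> snd d \<le> onorm A * (norm (fst d) * norm (snd d))"
      by (simp add: mult.assoc)
    have "(norm d)\<^sup>2 = (norm (fst d))\<^sup>2 + (norm (snd d))\<^sup>2"
      by (simp add: norm_prod_def)
    then have "c * (norm d)\<^sup>2 \<le> a * (norm (fst d))\<^sup>2 - 2 * onorm A * (norm (fst d) * norm (snd d)) + b * (norm (snd d))\<^sup>2"
      using c(2) by simp
    also have "\<dots> \<le> a * (norm (fst d))\<^sup>2 - 2 * (A (fst d) \<bullet> snd d) + b * (norm (snd d))\<^sup>2"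
      using cross by simp
    also have "\<dots> = pd_form A \<alpha> \<beta> d d - L\<^sub>f / 2 * (norm (fst d))\<^sup>2 - L\<^sub>g / 2 * (norm (snd d))\<^sup>2"
      by (simp add: pd_form_def a_def b_def dot_square_norm algebra_simps)
    finally show ?thesis .
  qed
  with c(1) show ?thesis
    by (rule that)
qed

section \<open>One step of the iteration\<close>

text \<open>The projection inequalities for \<open>u'\<close> and \<open>q'\<close>, divided by \<open>\<beta>\<close> and \<open>\<alpha>\<close> and added. Writing
  \<open>2 u' - u = u' + (u' - u)\<close> turns the coupling terms into the off-diagonal part of \<open>pd_form\<close> and the
  skew term \<open>A u' \<cdot> y - A x \<cdot> q'\<close>.\<close>
lemma primal_dual_step_variational:
  fixes C :: "'v::{real_inner, complete_space} set" and K :: "'w::{real_inner, complete_space} set"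
  assumes C: "C \<noteq> {}" "closed C" "convex C" and K: "K \<noteq> {}" "closed K" "convex K"
    and A: "bounded_linear A" and pos: "0 < \<alpha>" "0 < \<beta>"
    and u': "u' = proj C (u - \<beta> *\<^sub>R (adjoint A q + g))"
    and q': "q' = proj K (q + \<alpha> *\<^sub>R (A (2 *\<^sub>R u' - u) - h))"
    and xy: "x \<in> C" "y \<in> K"
  shows "pd_form A \<alpha> \<beta> ((u, q) - (u', q')) ((x, y) - (u', q')) - A x \<bullet> q' + A u' \<bullet> y
    \<le> g \<bullet> (x - u') + h \<bullet> (y - q')"
proof -
  interpret A: bounded_linear A
    by fact
  have "(u - \<beta> *\<^sub>R (adjoint A q + g) - u') \<bullet> (x - u') \<le> 0"
    unfolding u' by (rule proj_variational[OF C xy(1)])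
  also have "(u - \<beta> *\<^sub>R (adjoint A q + g) - u') \<bullet> (x - u')
      = \<beta> * ((u - u') \<bullet> (x - u') / \<beta> - A (x - u') \<bullet> q - g \<bullet> (x - u'))"
    using pos unfolding adjoint_inner[OF A] inner_commute[of "x - u'"]
    by (simp add: right_diff_distrib distrib_left diff_divide_distrib inner_diff_left inner_add_left)
  finally have primal: "(u - u') \<bullet> (x - u') / \<beta> - A (x - u') \<bullet> q - g \<bullet> (x - u') \<le> 0"
    using pos by (simp only: mult_le_0_iff) auto
  have "(q + \<alpha> *\<^sub>R (A (2 *\<^sub>R u' - u) - h) - q') \<bullet> (y - q') \<le> 0"
    unfolding q' by (rule proj_variational[OF K xy(2)])
  also have "(q + \<alpha> *\<^sub>R (A (2 *\<^sub>R u' - u) - h) - q') \<bullet> (y - q')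
      = \<alpha> * ((q - q') \<bullet> (y - q') / \<alpha> + A (2 *\<^sub>R u' - u) \<bullet> (y - q') - h \<bullet> (y - q'))"
    using pos by (simp add: inner_diff_left inner_add_left field_simps)
  finally have dual: "(q - q') \<bullet> (y - q') / \<alpha> + A (2 *\<^sub>R u' - u) \<bullet> (y - q') - h \<bullet> (y - q') \<le> 0"
    using pos by (simp only: mult_le_0_iff) auto
  have "pd_form A \<alpha> \<beta> ((u, q) - (u', q')) ((x, y) - (u', q')) - A x \<bullet> q' + A u' \<bullet> y
      = (u - u') \<bullet> (x - u') / \<beta> - A (x - u') \<bullet> q
        + ((q - q') \<bullet> (y - q') / \<alpha> + A (2 *\<^sub>R u' - u) \<bullet> (y - q'))"
    by (simp add: pd_form_def A.diff A.scaleR inner_diff algebra_simps)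
  with primal dual show ?thesis
    by linarith
qed

text \<open>First-order optimality of \<open>uh\<close> in the primal and of \<open>ph\<close> in the dual problem, added; the terms
  \<open>A uh \<cdot> ph\<close> cancel.\<close>
lemma saddle_point_variational:
  fixes A :: "'v::{real_inner, complete_space} \<Rightarrow> 'w::{real_inner, complete_space}"
  assumes C: "convex C" and K: "convex K" and A: "bounded_linear A"
    and F: "\<And>x. GDERIV F x :> F' x" and G: "\<And>y. GDERIV G y :> G' y"
    and s: "(uh, ph) \<in> saddle_points (lagrangian A F G) C K" and xy: "x \<in> C" "y \<in> K"
  shows "A uh \<bullet> y - A x \<bullet> ph \<le> F' uh \<bullet> (x - uh) + G' ph \<bullet> (y - ph)"
proof -
  interpret A: bounded_linear A
    by fact
  have sd: "uh \<in> C" "ph \<in> K"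
    "\<And>p. p \<in> K \<Longrightarrow> A uh \<bullet> p - G p \<le> A uh \<bullet> ph - G ph"
    "\<And>u. u \<in> C \<Longrightarrow> A uh \<bullet> ph + F uh \<le> A u \<bullet> ph + F u"
    using s by (fastforce simp: saddle_points_def lagrangian_def)+
  have "0 \<le> (F' uh + adjoint A ph) \<bullet> (x - uh)"
    using C sd(1) xy(1) F
  proof (rule first_order_optimality)
    show "F uh + adjoint A ph \<bullet> uh \<le> F z + adjoint A ph \<bullet> z" if "z \<in> C" for z
      using sd(4)[OF that] adjoint_inner[OF A, of uh ph] adjoint_inner[OF A, of z ph]
      by (simp add: inner_commute)
  qed
  moreover have "0 \<le> (G' ph + (- A uh)) \<bullet> (y - ph)"
    using K sd(2) xy(2) G
  proof (rule first_order_optimality)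
    show "G ph + (- A uh) \<bullet> ph \<le> G z + (- A uh) \<bullet> z" if "z \<in> K" for z
      using sd(3)[OF that] by simp
  qed
  moreover have "adjoint A ph \<bullet> (x - uh) = A (x - uh) \<bullet> ph"
    using adjoint_inner[OF A, of "x - uh" ph] by (simp add: inner_commute)
  ultimately show ?thesis
    by (simp add: inner_add_left inner_diff_left inner_diff_right A.diff)
qed

text \<open>The step is tested with the saddle point and the saddle point with the new iterate. The skew terms cancel, the
  three-point inequality bounds the gradients, and polarization of \<open>pd_form\<close> turns the result into a statement
  about squared distances.\<close>
lemma primal_dual_step_fejer:
  fixes C :: "'v::{real_inner, complete_space} set" and K :: "'w::{real_inner, complete_space} set"
  assumes C: "C \<noteq> {}" "closed C" "convex C" and K: "K \<noteq> {}" "closed K" "convex K"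
    and A: "bounded_linear A" and pos: "0 < \<alpha>" "0 < \<beta>"
    and F: "convex_on UNIV F" "\<And>x. GDERIV F x :> F' x" "L\<^sub>f-lipschitz_on UNIV F'"
    and G: "convex_on UNIV G" "\<And>y. GDERIV G y :> G' y" "L\<^sub>g-lipschitz_on UNIV G'"
    and z': "fst z' = proj C (fst z - \<beta> *\<^sub>R (adjoint A (snd z) + F' (fst z)))"
      "snd z' = proj K (snd z + \<alpha> *\<^sub>R (A (2 *\<^sub>R fst z' - fst z) - G' (snd z)))"
    and s: "s \<in> saddle_points (lagrangian A F G) C K"
  shows "pd_form A \<alpha> \<beta> (z' - s) (z' - s) \<le> pd_form A \<alpha> \<beta> (z - s) (z - s)
    - (pd_form A \<alpha> \<beta> (z - z') (z - z')
       - L\<^sub>f / 2 * (norm (fst (z - z')))\<^sup>2 - L\<^sub>g / 2 * (norm (snd (z - z')))\<^sup>2)"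
proof -
  interpret pd: bounded_bilinear "pd_form A \<alpha> \<beta>"
    using A by (rule bounded_bilinear_pd_form)
  obtain u q u' q' uh ph where eq: "z = (u, q)" "z' = (u', q')" "s = (uh, ph)"
    by (metis surj_pair)
  have in_sets: "uh \<in> C" "ph \<in> K" "u' \<in> C" "q' \<in> K"
    using s z' proj_in_set[OF C] proj_in_set[OF K] by (auto simp: saddle_points_def eq)
  have "pd_form A \<alpha> \<beta> (z - z') (s - z') - A uh \<bullet> q' + A u' \<bullet> ph
      \<le> F' u \<bullet> (uh - u') + G' q \<bullet> (ph - q')"
    using primal_dual_step_variational[OF C K A pos, of u' u q "F' u" q' "G' q" uh ph] z' in_sets
    by (simp add: eq)
  moreover have "A uh \<bullet> q' - A u' \<bullet> ph \<le> F' uh \<bullet> (u' - uh) + G' ph \<bullet> (q' - ph)"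
    using saddle_point_variational[OF C(3) K(3) A F(2) G(2) s[unfolded eq] in_sets(3,4)] .
  moreover have "(F' u - F' uh) \<bullet> (uh - u') \<le> L\<^sub>f / 4 * (norm (u - u'))\<^sup>2"
    by (rule gradient_three_point_inequality[OF F])
  moreover have "(G' q - G' ph) \<bullet> (ph - q') \<le> L\<^sub>g / 4 * (norm (q - q'))\<^sup>2"
    by (rule gradient_three_point_inequality[OF G])
  ultimately have "pd_form A \<alpha> \<beta> (z - z') (s - z')
      \<le> L\<^sub>f / 4 * (norm (fst (z - z')))\<^sup>2 + L\<^sub>g / 4 * (norm (snd (z - z')))\<^sup>2"
    by (simp add: eq inner_diff_left inner_diff_right)
  moreover have "pd_form A \<alpha> \<beta> (z' - s) (z' - s)
      = 2 * pd_form A \<alpha> \<beta> (z - z') (s - z') + pd_form A \<alpha> \<beta> (z - s) (z - s)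
        - pd_form A \<alpha> \<beta> (z - z') (z - z')"
    using pd_form_commute[of A \<alpha> \<beta> z s] pd_form_commute[of A \<alpha> \<beta> z' s] pd_form_commute[of A \<alpha> \<beta> z z']
    by (simp add: pd.diff_left pd.diff_right)
  ultimately show ?thesis
    by linarith
qed

section \<open>Convergence\<close>

lemma decreasing_with_gap:
  fixes D e :: "nat \<Rightarrow> real"
  assumes "\<And>n. 0 \<le> D n" "\<And>n. 0 \<le> e n" "\<And>n. D (Suc n) \<le> D n - e n"
  shows "convergent D" and "e \<longlonglongrightarrow> 0"
proof -
  have "decseq D"
    using assms(2,3) by (intro decseq_SucI) (metis diff_ge_0_iff_ge order_trans diff_le_eq le_add_same_cancel1)
  then obtain l where l: "D \<longlonglongrightarrow> l"
    using decseq_convergent[of D 0] assms(1) by metis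
  then show "convergent D"
    by (rule convergentI)
  have "(\<lambda>n. D n - D (Suc n)) \<longlonglongrightarrow> l - l"
    using l by (intro tendsto_diff LIMSEQ_Suc)
  then have "(\<lambda>n. D n - D (Suc n)) \<longlonglongrightarrow> 0"
    by simp
  moreover have "\<forall>n. e n \<le> D n - D (Suc n)"
    using assms(3) by (simp add: le_diff_eq add.commute)
  ultimately show "e \<longlonglongrightarrow> 0"
    using tendsto_sandwich[of "\<lambda>_. 0" e sequentially "\<lambda>n. D n - D (Suc n)" 0] assms(2)
    by simp
qed

lemma weak_tendsto_perturb:
  assumes "weak_tendsto x l H" "((\<lambda>i. x i - y i) \<longlongrightarrow> 0) H"
  shows "weak_tendsto y l H"
  unfolding weak_tendsto_def
proof (intro allI impI)
  fix \<phi> :: "'b \<Rightarrow> real"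
  assume \<phi>: "bounded_linear \<phi>"
  then interpret bounded_linear \<phi> .
  have "((\<lambda>i. \<phi> (x i) - \<phi> (x i - y i)) \<longlongrightarrow> \<phi> l - \<phi> 0) H"
  proof (rule tendsto_diff)
    show "((\<lambda>i. \<phi> (x i)) \<longlongrightarrow> \<phi> l) H"
      using assms(1) \<phi> by (simp add: weak_tendsto_def)
    show "((\<lambda>i. \<phi> (x i - y i)) \<longlongrightarrow> \<phi> 0) H"
      using assms(2) by (rule tendsto)
  qed
  then show "((\<lambda>i. \<phi> (y i)) \<longlongrightarrow> \<phi> l) H"
    by (simp add: diff zero)
qed

text \<open>A point outside \<open>D\<close> is separated from \<open>D\<close> by the functional that its projection residual defines.\<close>
lemma weak_limit_in_closed_convex:
  fixes D :: "'a::{real_inner, complete_space} set"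
  assumes D: "D \<noteq> {}" "closed D" "convex D" and "H \<noteq> bot"
    and "\<And>i. x i \<in> D" "weak_tendsto x l H"
  shows "l \<in> D"
proof -
  let ?d = "l - proj D l"
  have "((\<lambda>i. ?d \<bullet> x i) \<longlongrightarrow> ?d \<bullet> l) H"
    using assms(6) bounded_linear_inner_right by (auto simp: weak_tendsto_def)
  then have "?d \<bullet> l \<le> ?d \<bullet> proj D l"
    using proj_variational[OF D assms(5), of l] \<open>H \<noteq> bot\<close>
    by (intro tendsto_upperbound) (auto simp: inner_diff_right)
  then have "?d \<bullet> ?d \<le> 0"
    by (simp add: inner_diff_right)
  then have "?d \<bullet> ?d = 0"
    by (rule antisym) simp
  then have "l = proj D l"
    by simp
  then show ?thesis
    using proj_in_set[OF D, of l] by simp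
qed

text \<open>In the variational inequality of a step, convexity and the descent inequality replace the gradient terms
  by function values at the new iterate, up to the squared step; the gradient inequality at \<open>s\<close> then replaces these by affine functions
  of the iterate. Everything left is either weakly continuous or vanishes with the step, so the limit says that
  the Lagrangian satisfies \<open>L(ub, y) \<le> L(x, qb)\<close> for all \<open>x \<in> C\<close> and \<open>y \<in> K\<close>, which for
  \<open>ub \<in> C\<close> and \<open>qb \<in> K\<close> characterizes saddle points.\<close>
lemma weak_cluster_point_is_saddle_point:
  fixes C :: "'v::{real_inner, complete_space} set" and K :: "'w::{real_inner, complete_space} set"
  assumes C: "C \<noteq> {}" "closed C" "convex C" and K: "K \<noteq> {}" "closed K" "convex K"
    and A: "bounded_linear A" and pos: "0 < \<alpha>" "0 < \<beta>"
    and F: "convex_on UNIV F" "\<And>x. GDERIV F x :> F' x" "L\<^sub>f-lipschitz_on UNIV F'"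
    and G: "convex_on UNIV G" "\<And>y. GDERIV G y :> G' y" "L\<^sub>g-lipschitz_on UNIV G'"
    and z: "\<And>n. fst (z (Suc n)) = proj C (fst (z n) - \<beta> *\<^sub>R (adjoint A (snd (z n)) + F' (fst (z n))))"
      "\<And>n. snd (z (Suc n)) = proj K (snd (z n) + \<alpha> *\<^sub>R (A (2 *\<^sub>R fst (z (Suc n)) - fst (z n)) - G' (snd (z n))))"
    and bnd: "\<And>n. norm (z n) \<le> M" and step: "(\<lambda>n. z n - z (Suc n)) \<longlonglongrightarrow> 0"
    and H: "H \<noteq> bot" "H \<le> sequentially" and wk: "weak_tendsto z s H"
  shows "s \<in> saddle_points (lagrangian A F G) C K"
proof -
  interpret A: bounded_linear A
    by fact
  interpret pd: bounded_bilinear "pd_form A \<alpha> \<beta>"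
    using A by (rule bounded_bilinear_pd_form)
  define \<Delta> where "\<Delta> n = z n - z (Suc n)" for n
  define u q where "u n = fst (z (Suc n))" and "q n = snd (z (Suc n))" for n
  obtain ub qb where s: "s = (ub, qb)"
    by (metis surj_pair)
  have \<Delta>: "(\<Delta> \<longlongrightarrow> 0) H"
    using step H(2) unfolding \<Delta>_def by (rule tendsto_mono[rotated])
  have wk': "weak_tendsto (\<lambda>n. z (Suc n)) s H"
    using wk \<Delta> unfolding \<Delta>_def by (rule weak_tendsto_perturb)
  have wk_fst: "((\<lambda>n. \<phi> (u n)) \<longlongrightarrow> \<phi> ub) H" if "bounded_linear \<phi>" for \<phi> :: "'v \<Rightarrow> real"
    using wk' bounded_linear_compose[OF that bounded_linear_fst] by (auto simp: weak_tendsto_def u_def s)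
  have wk_snd: "((\<lambda>n. \<phi> (q n)) \<longlongrightarrow> \<phi> qb) H" if "bounded_linear \<phi>" for \<phi> :: "'w \<Rightarrow> real"
    using wk' bounded_linear_compose[OF that bounded_linear_snd] by (auto simp: weak_tendsto_def q_def s)
  have uC: "u n \<in> C" and qK: "q n \<in> K" for n
    using proj_in_set[OF C] proj_in_set[OF K] z by (auto simp: u_def q_def)
  have "weak_tendsto u ub H"
    using wk_fst by (simp add: weak_tendsto_def)
  then have ub: "ub \<in> C"
    by (rule weak_limit_in_closed_convex[OF C H(1) uC])
  have "weak_tendsto q qb H"
    using wk_snd by (simp add: weak_tendsto_def)
  then have qb: "qb \<in> K"
    by (rule weak_limit_in_closed_convex[OF K H(1) qK])
  have gap: "A ub \<bullet> y - A x \<bullet> qb \<le> F x - F ub + (G y - G qb)" if xy: "x \<in> C" "y \<in> K" for x y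
  proof -
    define lhs where "lhs n = pd_form A \<alpha> \<beta> (\<Delta> n) ((x, y) - z (Suc n)) - A x \<bullet> q n + A (u n) \<bullet> y" for n
    define rhs where "rhs n = F x - F ub - F' ub \<bullet> (u n - ub) + L\<^sub>f / 2 * (norm (fst (\<Delta> n)))\<^sup>2
        + (G y - G qb - G' qb \<bullet> (q n - qb) + L\<^sub>g / 2 * (norm (snd (\<Delta> n)))\<^sup>2)" for n
    have "lhs n \<le> rhs n" for n
    proof -
      have "lhs n \<le> F' (fst (z n)) \<bullet> (x - u n) + G' (snd (z n)) \<bullet> (y - q n)"
        using primal_dual_step_variational[OF C K A pos z(1)[of n, folded u_def]
            z(2)[of n, folded u_def q_def] xy]
        by (simp add: lhs_def u_def q_def \<Delta>_def)
      moreover have "F' (fst (z n)) \<bullet> (x - u n) \<le> F x - F (u n) + L\<^sub>f / 2 * (norm (fst (\<Delta> n)))\<^sup>2"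
        using convex_gradient_inequality[OF F(1,2), of "fst (z n)" x]
          descent_inequality[OF F(2,3), of "u n" "fst (z n)"]
        by (simp add: u_def \<Delta>_def inner_diff_right norm_minus_commute)
      moreover have "G' (snd (z n)) \<bullet> (y - q n) \<le> G y - G (q n) + L\<^sub>g / 2 * (norm (snd (\<Delta> n)))\<^sup>2"
        using convex_gradient_inequality[OF G(1,2), of "snd (z n)" y]
          descent_inequality[OF G(2,3), of "q n" "snd (z n)"]
        by (simp add: q_def \<Delta>_def inner_diff_right norm_minus_commute)
      ultimately show ?thesis
        using convex_gradient_inequality[OF F(1,2), of ub "u n"]
          convex_gradient_inequality[OF G(1,2), of qb "q n"]
        by (simp add: rhs_def)
    qed
    moreover have "(lhs \<longlongrightarrow> 0 - A x \<bullet> qb + A ub \<bullet> y) H"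
    proof -
      have "Bfun (\<lambda>n. (x, y) - z (Suc n)) H"
        by (rule BfunI[of _ "norm (x, y) + M"])
          (intro always_eventually allI order_trans[OF norm_triangle_ineq4 add_left_mono[OF bnd]])
      moreover have "Zfun \<Delta> H"
        using \<Delta> by (simp add: tendsto_Zfun_iff)
      ultimately have "Zfun (\<lambda>n. pd_form A \<alpha> \<beta> (\<Delta> n) ((x, y) - z (Suc n))) H"
        using pd.Zfun_prod_Bfun by blast
      then have "((\<lambda>n. pd_form A \<alpha> \<beta> (\<Delta> n) ((x, y) - z (Suc n))) \<longlongrightarrow> 0) H"
        by (simp add: tendsto_Zfun_iff)
      then show ?thesis
        unfolding lhs_def
        by (intro tendsto_add tendsto_diff wk_fst wk_snd bounded_linear_inner_right
            bounded_linear_inner_left_comp A)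
    qed
    moreover have "(rhs \<longlongrightarrow> F x - F ub - F' ub \<bullet> (ub - ub) + L\<^sub>f / 2 * (norm (fst (0::'v \<times> 'w)))\<^sup>2
        + (G y - G qb - G' qb \<bullet> (qb - qb) + L\<^sub>g / 2 * (norm (snd (0::'v \<times> 'w)))\<^sup>2)) H"
      unfolding rhs_def inner_diff_right
      by (intro tendsto_intros wk_fst wk_snd bounded_linear_inner_right \<Delta>)
    ultimately have "0 - A x \<bullet> qb + A ub \<bullet> y \<le> F x - F ub - F' ub \<bullet> (ub - ub) + L\<^sub>f / 2 * (norm (fst (0::'v \<times> 'w)))\<^sup>2
        + (G y - G qb - G' qb \<bullet> (qb - qb) + L\<^sub>g / 2 * (norm (snd (0::'v \<times> 'w)))\<^sup>2)"
      using H(1) by (intro tendsto_le[of H rhs _ lhs]) auto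
    then show ?thesis
      by simp
  qed
  show ?thesis
    using gap[OF ub] gap[OF _ qb] ub qb by (fastforce simp: saddle_points_def lagrangian_def s)
qed

theorem theorem2p1:
  fixes C :: "'v::{real_inner, complete_space} set"
    and K :: "'w::{real_inner, complete_space} set"
    and A :: "'v \<Rightarrow> 'w"
    and F :: "'v \<Rightarrow> real" and F' :: "'v \<Rightarrow> 'v"
    and G :: "'w \<Rightarrow> real" and G' :: "'w \<Rightarrow> 'w"
    and L\<^sub>f L\<^sub>g \<alpha> \<beta> :: real
    and u ubar :: "nat \<Rightarrow> 'v" and p :: "nat \<Rightarrow> 'w"
  assumes "C \<noteq> {}" "closed C" "convex C"
    and "K \<noteq> {}" "closed K" "convex K"
    and "bounded_linear A"
    and "convex_on UNIV F" "\<And>x. GDERIV F x :> F' x" "L\<^sub>f-lipschitz_on UNIV F'"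
    and "convex_on UNIV G" "\<And>y. GDERIV G y :> G' y" "L\<^sub>g-lipschitz_on UNIV G'"
    and "saddle_points (lagrangian A F G) C K \<noteq> {}"
    and "0 < \<alpha>" "L\<^sub>g \<noteq> 0 \<longrightarrow> \<alpha> < 2 / L\<^sub>g"
    and "0 < \<beta>" "L\<^sub>f \<noteq> 0 \<longrightarrow> \<beta> < 2 / L\<^sub>f"
    and "\<alpha> * \<beta> * ((onorm A)\<^sup>2 - L\<^sub>f * L\<^sub>g / 4) + \<alpha> * L\<^sub>g / 2 + \<beta> * L\<^sub>f / 2 < 1"
    and "u 0 \<in> C" "p 0 \<in> K" "ubar 0 = u 0"
    and "\<And>n. p (Suc n) = proj K (p n + \<alpha> *\<^sub>R (A (ubar n) - G' (p n)))"
    and "\<And>n. u (Suc n) = proj C (u n - \<beta> *\<^sub>R (adjoint A (p (Suc n)) + F' (u n)))"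
    and "\<And>n. ubar (Suc n) = 2 *\<^sub>R u (Suc n) - u n"
  shows "\<exists>s \<in> saddle_points (lagrangian A F G) C K. weakly_converges (\<lambda>n. (u n, p n)) s"
proof -
  \<comment> \<open>The dual variable is taken one step ahead, since \<open>u (Suc n)\<close> is computed from \<open>p (Suc n)\<close>.\<close>
  define z where "z n = (u n, p (Suc n))" for n
  let ?Q = "pd_form A \<alpha> \<beta>" and ?S = "saddle_points (lagrangian A F G) C K"
  note C = assms(1-3) and K = assms(4-6) and A = assms(7) and F = assms(8-10) and G = assms(11-13)
    and pos = assms(15,17)
  have z: "fst (z (Suc n)) = proj C (fst (z n) - \<beta> *\<^sub>R (adjoint A (snd (z n)) + F' (fst (z n))))"
    "snd (z (Suc n)) = proj K (snd (z n) + \<alpha> *\<^sub>R (A (2 *\<^sub>R fst (z (Suc n)) - fst (z n)) - G' (snd (z n))))" for n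
    using assms(23)[of "Suc n"] assms(24)[of n] assms(25)[of n] by (simp_all add: z_def)
  have L: "0 \<le> L\<^sub>f" "0 \<le> L\<^sub>g"
    using F(3) G(3) by (simp_all add: lipschitz_on_nonneg)
  obtain c where c: "0 < c" "\<And>d. c * (norm d)\<^sup>2 \<le> ?Q d d - L\<^sub>f / 2 * (norm (fst d))\<^sup>2 - L\<^sub>g / 2 * (norm (snd d))\<^sup>2"
    using pd_form_coercive[OF A pos L assms(16,18,19)] by blast
  have coercive: "c * (norm d)\<^sup>2 \<le> ?Q d d" for d
  proof -
    have "0 \<le> L\<^sub>f / 2 * (norm (fst d))\<^sup>2" "0 \<le> L\<^sub>g / 2 * (norm (snd d))\<^sup>2"
      using L by simp_all
    with c(2)[of d] show ?thesis
      by linarith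
  qed
  have nonneg: "0 \<le> c * (norm d)\<^sup>2" for d :: "'v \<times> 'w"
    using c(1) by simp
  have fejer: "convergent (\<lambda>n. ?Q (z n - s) (z n - s))" "(\<lambda>n. c * (norm (z n - z (Suc n)))\<^sup>2) \<longlonglongrightarrow> 0"
    if "s \<in> ?S" for s
  proof -
    have D: "0 \<le> ?Q (z n - s) (z n - s)" for n
      using coercive nonneg order_trans by blast
    have dec: "?Q (z (Suc n) - s) (z (Suc n) - s) \<le> ?Q (z n - s) (z n - s) - c * (norm (z n - z (Suc n)))\<^sup>2" for n
      using primal_dual_step_fejer[OF C K A pos F G z that, of n] c(2)[of "z n - z (Suc n)"] by linarith
    show "convergent (\<lambda>n. ?Q (z n - s) (z n - s))"
      by (rule decreasing_with_gap(1)[of "\<lambda>n. ?Q (z n - s) (z n - s)"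
            "\<lambda>n. c * (norm (z n - z (Suc n)))\<^sup>2", OF D nonneg dec])
    show "(\<lambda>n. c * (norm (z n - z (Suc n)))\<^sup>2) \<longlonglongrightarrow> 0"
      by (rule decreasing_with_gap(2)[of "\<lambda>n. ?Q (z n - s) (z n - s)"
            "\<lambda>n. c * (norm (z n - z (Suc n)))\<^sup>2", OF D nonneg dec])
  qed
  obtain s\<^sub>0 where s\<^sub>0: "s\<^sub>0 \<in> ?S"
    using assms(14) by blast
  have step: "(\<lambda>n. z n - z (Suc n)) \<longlonglongrightarrow> 0"
  proof -
    have "(\<lambda>n. sqrt (inverse c * (c * (norm (z n - z (Suc n)))\<^sup>2))) \<longlonglongrightarrow> sqrt (inverse c * 0)"
      by (intro tendsto_intros fejer(2)[OF s\<^sub>0])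
    moreover have "sqrt (inverse c * (c * (norm d)\<^sup>2)) = norm d" for d :: "'v \<times> 'w"
      using c(1) by (simp add: mult.assoc[symmetric])
    ultimately show ?thesis
      by (simp add: tendsto_norm_zero_iff)
  qed
  obtain M where M: "\<And>n. norm (z n) \<le> M"
    using coercive_form_convergent_imp_bounded[of c ?Q z s\<^sub>0, OF c(1) coercive fejer(1)[OF s\<^sub>0]] by blast
  have "\<exists>s\<in>?S. weakly_converges z s"
  proof (rule opial_weak_convergence)
    show "bounded_bilinear ?Q"
      using A by (rule bounded_bilinear_pd_form)
    show "?Q x y = ?Q y x" for x y
      by (rule pd_form_commute)
    show "s \<in> ?S" if "H \<noteq> bot" "H \<le> sequentially" "weak_tendsto z s H" for H s
      by (rule weak_cluster_point_is_saddle_point[OF C K A pos F G z M step that])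
  qed (fact assms(14) c(1) coercive fejer(1))+
  then obtain s where s: "s \<in> ?S" "weakly_converges z s"
    by blast
  have "(\<lambda>n. z (Suc n) - (u (Suc n), p (Suc n))) \<longlonglongrightarrow> 0"
  proof -
    have "(\<lambda>n. (0::'v, - snd (z n - z (Suc n)))) \<longlonglongrightarrow> (0, - snd (0::'v \<times> 'w))"
      by (intro tendsto_intros step)
    then show ?thesis
      by (simp add: z_def zero_prod_def)
  qed
  then have "(\<lambda>n. z n - (u n, p n)) \<longlonglongrightarrow> 0"
    by (rule LIMSEQ_imp_Suc)
  then have "weakly_converges (\<lambda>n. (u n, p n)) s"
    using weak_tendsto_perturb[of z s sequentially] s(2)
    by (simp add: weakly_converges_def weak_tendsto_def)
  with s(1) show ?thesis
    by blast
qed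

end
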